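(* Let $B_1,\dots,B_t$ be batches, $t>1$, with means $\bm{\mu}(B_s)\in\mathbb{R}^n$, partitioned into $M$ mutually exclusive nonempty clusters $G^1,\dots,G^M$. Assume the clusters are well-separated: there exists $\theta>0$ such that $$\operatorname{diam}(\operatorname{Conv}(G^i)) < \theta < d(\operatorname{Conv}(G^i),\operatorname{Conv}(G^j)) \quad\text{for all } i\neq j .$$ Then for every permutation $\pi$ of $\{1,\dots,t-1\}$, when the coreset algorithm (described in the context) with threshold $\theta$ is run on the sequence $B_{\pi(1)},\dots,B_{\pi(t-1)},B_t$, it assigns $B_t$ to the correct cluster, independently of $\pi$. Furthermore, if at every update of a core element corresponding to cluster $j$ the updating weight is $\alpha=\frac{1}{|G^j|}$, where $|G^j|$ denotes the number of batches of cluster $j$ processed so far, including the current one, then after all $t$ batches are processed the core mean of the core element of each cluster $i$ is the cluster mean, $$\bm{\mu}^i_t=\frac{1}{|G^i_t|}\sum_{B\in G^i_t}\bm{\mu}(B),$$ which is also independent of $\pi$; here $G^i_t$ is the set of batches of cluster $i$ among $B_1,\dots,B_t$.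
   Context: Distances: $d$ is the Euclidean distance on $\mathbb{R}^n$; each batch $B$ has a mean vector $\bm{\mu}(B)\in\mathbb{R}^n$ (the mean of its features). For a cluster $G$, $\operatorname{Conv}(G)$ is the convex hull in $\mathbb{R}^n$ of the means $\{\bm{\mu}(B): B\in G\}$. For sets $S,S'$: $\operatorname{diam}(S)=\sup_{x,x'\in S}d(x,x')$ and $d(S,S')=\inf_{x\in S,x'\in S'}d(x,x')$. The algorithm: It maintains a list (coreset) of core elements, initially empty. Each core element $j$ stores a core mean $\bm{\mu}^j\in\mathbb{R}^n$ and a core prompt $\bm{p}^j$ (a parameter vector; prompts play no role in the decisions about assignment). It processes the given sequence of batches one at a time. Given the current batch $B$: 1. Compute $d^j=d(\bm{\mu}(B),\bm{\mu}^j)$ for all existing core elements $j$. 2. If the coreset is empty or $\min_j d^j>\theta$: create a new core element with mean $\bm{\mu}(B)$ and a prompt learned from scratch on $B$; $B$ is assigned to this new core element. 3. Otherwise: assign $B$ to the closest core element $j^*=\arg\min_j d^j$, replace its prompt by an updated prompt, and update its mean by $$\bm{\mu}^{j^*}\leftarrow(1-\alpha)\,\bm{\mu}^{j^*}+\alpha\,\bm{\mu}(B).$$ All other core elements are unchanged. Here $\alpha\in[0,1]$ is the updating weight (it may depend on the step). "$B_t$ is assigned to the correct cluster" means: if some earlier batch lies in the same cluster as $B_t$, then $B_t$ is assigned to the core element to which exactly the earlier batches of that cluster were assigned; otherwise $B_t$ creates a new core element. The core element to which the batches of cluster $i$ are assigned is called the core element of cluster $i$, and $\bm{\mu}^i_t$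 denotes its mean after all $t$ batches are processed. *)

theory Defs
  imports "HOL-Analysis.Analysis"
begin

datatype ('v, 'p) core_elem = Core (core_mean: 'v) (core_prompt: 'p)

text \<open>
  The coreset is a list, and core elements are identified by their position in it: elements are
  only ever appended or modified in place, so positions never change.

  \<open>coreset_step \<theta> \<mu> \<alpha> b cs j cs'\<close>: processing the batch \<open>b\<close> may turn the coreset \<open>cs\<close> into \<open>cs'\<close>
  and assign \<open>b\<close> to the core element \<open>j\<close>, where \<open>\<alpha>\<close> is the weight used if an element is updated.
  It is a relation for two reasons: ties for the closest core element may be broken either way,
  and the new prompt \<open>p\<close> is left open (any learning procedure is allowed), as the
  assignment of batches does not depend on it.
\<close>

inductive coreset_step ::
  "real \<Rightarrow> ('b \<Rightarrow> real ^ 'n) \<Rightarrow> real \<Rightarrow> 'b \<Rightarrow> (real ^ 'n, 'p) core_elem list \<Rightarrow> nat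
    \<Rightarrow> (real ^ 'n, 'p) core_elem list \<Rightarrow> bool"
  for \<theta> :: real and \<mu> :: "'b \<Rightarrow> real ^ 'n" and \<alpha> :: real and b :: 'b
    and cs :: "(real ^ 'n, 'p) core_elem list"
where
  create: "cs = [] \<or> Min ((\<lambda>c. dist (\<mu> b) (core_mean c)) ` set cs) > \<theta> \<Longrightarrow>
    coreset_step \<theta> \<mu> \<alpha> b cs (length cs) (cs @ [Core (\<mu> b) p])"
| update: "cs \<noteq> [] \<Longrightarrow> Min ((\<lambda>c. dist (\<mu> b) (core_mean c)) ` set cs) \<le> \<theta> \<Longrightarrow>
    is_arg_min (\<lambda>j. dist (\<mu> b) (core_mean (cs ! j))) (\<lambda>j. j < length cs) j \<Longrightarrow>
    0 \<le> \<alpha> \<Longrightarrow> \<alpha> \<le> 1 \<Longrightarrow>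
    coreset_step \<theta> \<mu> \<alpha> b cs j
      (cs[j := Core ((1 - \<alpha>) *\<^sub>R core_mean (cs ! j) + \<alpha> *\<^sub>R \<mu> b) p])"

text \<open>
  A run on \<open>X 1, \<dots>, X t\<close>: \<open>cs s\<close> is the coreset after \<open>s\<close> batches, and in step \<open>s\<close> the batch \<open>X s\<close>
  is assigned to the core element \<open>a s\<close>, with weight \<open>\<alpha> s\<close> if this is an update.
\<close>

definition coreset_run ::
  "real \<Rightarrow> ('b \<Rightarrow> real ^ 'n) \<Rightarrow> (nat \<Rightarrow> 'b) \<Rightarrow> nat \<Rightarrow> (nat \<Rightarrow> real)
    \<Rightarrow> (nat \<Rightarrow> (real ^ 'n, 'p) core_elem list) \<Rightarrow> (nat \<Rightarrow> nat) \<Rightarrow> bool"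
where
  "coreset_run \<theta> \<mu> X t \<alpha> cs a \<longleftrightarrow>
     cs 0 = [] \<and> (\<forall>s\<in>{1..t}. coreset_step \<theta> \<mu> (\<alpha> s) (X s) (cs (s - 1)) (a s) (cs s))"

text \<open>
  Batches are referred to by their indices, so that equal batches at different indices count
  separately. Below, \<open>\<sigma> s\<close> is the index of the batch processed in step \<open>s\<close>, and a cluster \<open>C\<close> is a
  set of indices.
\<close>

definition batches_of_core :: "(nat \<Rightarrow> nat) \<Rightarrow> (nat \<Rightarrow> nat) \<Rightarrow> nat \<Rightarrow> nat \<Rightarrow> nat set" where
  "batches_of_core \<sigma> a s k = \<sigma> ` {r \<in> {1..s}. a r = k}"

definition processed :: "(nat \<Rightarrow> nat) \<Rightarrow> nat \<Rightarrow> nat set \<Rightarrow> nat set" where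
  "processed \<sigma> s C = C \<inter> \<sigma> ` {1..s}"

text \<open>
  \<open>C\<close> is meant to be the cluster containing \<open>\<sigma> s\<close>. The core element \<open>a s\<close> is a new one iff its
  position is the length of the coreset before step \<open>s\<close>.
\<close>

definition correctly_assigned ::
  "(nat \<Rightarrow> nat) \<Rightarrow> (nat \<Rightarrow> 'c list) \<Rightarrow> (nat \<Rightarrow> nat) \<Rightarrow> nat set \<Rightarrow> nat \<Rightarrow> bool"
where
  "correctly_assigned \<sigma> cs a C s \<longleftrightarrow>
     (if processed \<sigma> (s - 1) C \<noteq> {}
      then a s < length (cs (s - 1)) \<and> batches_of_core \<sigma> a (s - 1) (a s) = processed \<sigma> (s - 1) C
      else a s = length (cs (s - 1)))"

definition core_of_cluster ::
  "(nat \<Rightarrow> nat) \<Rightarrow> (nat \<Rightarrow> 'c list) \<Rightarrow> (nat \<Rightarrow> nat) \<Rightarrow> nat \<Rightarrow> nat set \<Rightarrow> nat \<Rightarrow> bool"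
where
  "core_of_cluster \<sigma> cs a s C k \<longleftrightarrow>
     k < length (cs s) \<and> processed \<sigma> s C \<noteq> {} \<and> batches_of_core \<sigma> a s k = processed \<sigma> s C"

text \<open>Runs exist for all admissible choices of the weights.\<close>

lemma coreset_step_exists:
  assumes "0 \<le> \<alpha>" "\<alpha> \<le> 1"
  shows "\<exists>j cs'. coreset_step \<theta> \<mu> \<alpha> b cs j cs'"
proof (cases "cs = [] \<or> Min ((\<lambda>c. dist (\<mu> b) (core_mean c)) ` set cs) > \<theta>")
  case True
  then have "coreset_step \<theta> \<mu> \<alpha> b cs (length cs) (cs @ [Core (\<mu> b) undefined])"
    by (rule coreset_step.create)
  then show ?thesis by (intro exI)
next
  case False
  have "{j. j < length cs} \<noteq> {}" using False by auto
  from ex_is_arg_min_if_finite[OF _ this]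
  have "\<exists>j. is_arg_min (\<lambda>j. dist (\<mu> b) (core_mean (cs ! j))) (\<lambda>j. j < length cs) j"
    by simp
  then obtain j where j:
    "is_arg_min (\<lambda>j. dist (\<mu> b) (core_mean (cs ! j))) (\<lambda>j. j < length cs) j" ..
  from False have "cs \<noteq> []" "Min ((\<lambda>c. dist (\<mu> b) (core_mean c)) ` set cs) \<le> \<theta>"
    by (simp_all add: not_less)
  from coreset_step.update[of cs \<mu> b \<theta> j \<alpha> undefined, OF this j assms] show ?thesis by (intro exI)
qed

lemma coreset_run_exists:
  fixes \<mu> :: "'b \<Rightarrow> real ^ 'n"
  assumes "\<And>s. s \<in> {1..t} \<Longrightarrow> 0 \<le> \<alpha> s \<and> \<alpha> s \<le> 1"
  shows "\<exists>cs :: nat \<Rightarrow> (real ^ 'n, 'p) core_elem list. \<exists>a. coreset_run \<theta> \<mu> X t \<alpha> cs a"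
  using assms
proof (induction t)
  case 0
  show ?case by (rule exI[of _ "\<lambda>_. []"]) (simp add: coreset_run_def)
next
  case (Suc t)
  have "\<exists>cs :: nat \<Rightarrow> (real ^ 'n, 'p) core_elem list. \<exists>a. coreset_run \<theta> \<mu> X t \<alpha> cs a"
    by (rule Suc.IH, rule Suc.prems) simp
  then obtain cs :: "nat \<Rightarrow> (real ^ 'n, 'p) core_elem list" and a
    where run: "coreset_run \<theta> \<mu> X t \<alpha> cs a" by blast
  have "0 \<le> \<alpha> (Suc t)" "\<alpha> (Suc t) \<le> 1" using Suc.prems[of "Suc t"] by simp_all
  from coreset_step_exists[OF this, of \<theta> \<mu> "X (Suc t)" "cs t"] obtain j
    and cs' :: "(real ^ 'n, 'p) core_elem list"
    where "coreset_step \<theta> \<mu> (\<alpha> (Suc t)) (X (Suc t)) (cs t) j cs'" by blast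
  with run have "coreset_run \<theta> \<mu> X (Suc t) \<alpha> (cs(Suc t := cs')) (a(Suc t := j))"
    unfolding coreset_run_def by (auto simp: le_Suc_eq)
  then show ?case by (intro exI)
qed

end

theory Submission imports Defs begin

text \<open>
  Each core mean is a convex combination of batches of a single cluster, so it stays in the convex
  hull of that cluster. A new batch is therefore within \<open>\<theta>\<close> of the core mean of its own cluster, if
  there is one, and farther than \<open>\<theta>\<close> from all others, which forces the decision of the algorithm
  whatever the order, the weights and the tie-breaking. With weight \<open>1 / n\<close> for the \<open>n\<close>-th batch of
  a cluster, the update is the recursion for the running average.
\<close>

section \<open>One step when the threshold separates the core elements\<close>

text \<open>\<open>P\<close> is meant to mark the core elements of the cluster of \<open>b\<close>.
  A marked element rules out creation, since it keeps the minimum at most \<theta>. In an update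
  every minimizer lies within \<theta> and is therefore marked, so tie-breaking cannot lead to a
  wrong cluster.\<close>

lemma coreset_step_separatedE:
  fixes \<mu> :: "'b \<Rightarrow> real ^ 'n" and L :: "(real ^ 'n, 'p) core_elem list"
  assumes step: "coreset_step \<theta> \<mu> \<alpha> b L j L'"
    and near: "\<And>k. k < length L \<Longrightarrow> P k \<Longrightarrow> dist (\<mu> b) (core_mean (L ! k)) \<le> \<theta>"
    and far: "\<And>k. k < length L \<Longrightarrow> \<not> P k \<Longrightarrow> dist (\<mu> b) (core_mean (L ! k)) > \<theta>"
  obtains
    (create) p where "\<And>k. k < length L \<Longrightarrow> \<not> P k" "j = length L" "L' = L @ [Core (\<mu> b) p]"
  | (update) p where "j < length L" "P j" "0 \<le> \<alpha>" "\<alpha> \<le> 1"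
      "L' = L[j := Core ((1 - \<alpha>) *\<^sub>R core_mean (L ! j) + \<alpha> *\<^sub>R \<mu> b) p]"
  using step
proof cases
  case (create p)
  have "\<not> P k" if k: "k < length L" for k
  proof
    assume "P k"
    have "L \<noteq> []" using k by auto
    then have "\<theta> < dist (\<mu> b) (core_mean (L ! k))" using create k by auto
    with near[OF k \<open>P k\<close>] show False by simp
  qed
  with create that(1) show thesis by blast
next
  case (update p)
  have j: "j < length L"
    and min: "\<And>k. k < length L \<Longrightarrow> dist (\<mu> b) (core_mean (L ! j)) \<le> dist (\<mu> b) (core_mean (L ! k))"
    using update by (auto simp: is_arg_min_linorder)
  \<comment> \<open>The minimum of a finite nonempty set is attained, so some position lies within
    \<theta>. The closest one, \<open>j\<close>, is no farther away, and \<open>far\<close> then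
    forces \<open>P j\<close>.\<close>
  have "Min ((\<lambda>c. dist (\<mu> b) (core_mean c)) ` set L) \<in> (\<lambda>c. dist (\<mu> b) (core_mean c)) ` set L"
    using update by (intro Min_in) auto
  then obtain e where "e \<in> set L" "dist (\<mu> b) (core_mean e) \<le> \<theta>"
    using update(3) by (metis (no_types, lifting) imageE)
  then obtain k where "k < length L" "dist (\<mu> b) (core_mean (L ! k)) \<le> \<theta>"
    by (metis in_set_conv_nth)
  then have "P j" using min far[OF j] by force
  with update j that(2) show thesis by blast
qed

section \<open>The invariant along a run\<close>

text \<open>
  \<open>c r\<close> is the label of the cluster of the \<open>r\<close>-th batch processed, and \<open>V i\<close> a region containing the
  cluster with label \<open>i\<close>.
\<close>

definition tracks ::
  "(nat \<Rightarrow> 'v set) \<Rightarrow> (nat \<Rightarrow> nat) \<Rightarrow> nat \<Rightarrow> ('v, 'p) core_elem list \<Rightarrow> (nat \<Rightarrow> nat) \<Rightarrow> bool"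
where
  "tracks V c s L a \<longleftrightarrow>
     a ` {1..s} = {..<length L} \<and>
     (\<forall>q\<in>{1..s}. \<forall>r\<in>{1..s}. a q = a r \<longleftrightarrow> c q = c r) \<and>
     (\<forall>r\<in>{1..s}. core_mean (L ! a r) \<in> V (c r))"

text \<open>Labels are attached to steps, with \<open>X\<close> already in processing order, so the
  argument never mentions a permutation. The bounds in \<open>near\<close> and \<open>far\<close>
  mirror the test of the algorithm, which updates at distance at most \<theta> and creates beyond
  it.\<close>

locale separated_run =
  fixes \<theta> :: real and \<mu> :: "'b \<Rightarrow> real ^ 'n" and X :: "nat \<Rightarrow> 'b" and t :: nat
    and \<alpha> :: "nat \<Rightarrow> real" and cs :: "nat \<Rightarrow> (real ^ 'n, 'p) core_elem list" and a :: "nat \<Rightarrow> nat"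
    and V :: "nat \<Rightarrow> (real ^ 'n) set" and c :: "nat \<Rightarrow> nat"
  assumes run: "coreset_run \<theta> \<mu> X t \<alpha> cs a"
    and mean_in: "\<And>r. r \<in> {1..t} \<Longrightarrow> \<mu> (X r) \<in> V (c r)"
    and convex_V: "\<And>r. r \<in> {1..t} \<Longrightarrow> convex (V (c r))"
    and near: "\<And>r x y. r \<in> {1..t} \<Longrightarrow> x \<in> V (c r) \<Longrightarrow> y \<in> V (c r) \<Longrightarrow> dist x y \<le> \<theta>"
    and far: "\<And>q r x y. q \<in> {1..t} \<Longrightarrow> r \<in> {1..t} \<Longrightarrow> c q \<noteq> c r \<Longrightarrow>
      x \<in> V (c q) \<Longrightarrow> y \<in> V (c r) \<Longrightarrow> dist x y > \<theta>"
begin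

text \<open>This rephrases the two outcomes of a step in terms of labels. An update comes with an
  earlier step \<open>r\<close> of the same label, because the invariant describes positions only in
  the form \<open>a r\<close>.\<close>

lemma stepE:
  assumes s: "Suc s \<le> t" and tr: "tracks V c s (cs s) a"
  obtains
    (create) p where "\<And>r. r \<in> {1..s} \<Longrightarrow> c r \<noteq> c (Suc s)" "a (Suc s) = length (cs s)"
      "cs (Suc s) = cs s @ [Core (\<mu> (X (Suc s))) p]"
  | (update) p r where "r \<in> {1..s}" "c r = c (Suc s)" "a (Suc s) = a r" "a r < length (cs s)"
      "0 \<le> \<alpha> (Suc s)" "\<alpha> (Suc s) \<le> 1"
      "cs (Suc s) = (cs s)[a r := Core ((1 - \<alpha> (Suc s)) *\<^sub>R core_mean (cs s ! a r)
         + \<alpha> (Suc s) *\<^sub>R \<mu> (X (Suc s))) p]"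
proof -
  let ?P = "\<lambda>k. \<exists>r\<in>{1..s}. a r = k \<and> c r = c (Suc s)"
  have "Suc s \<in> {1..t}" using s by simp
  then have step: "coreset_step \<theta> \<mu> (\<alpha> (Suc s)) (X (Suc s)) (cs s) (a (Suc s)) (cs (Suc s))"
    using run unfolding coreset_run_def by fastforce
  have x: "\<mu> (X (Suc s)) \<in> V (c (Suc s))" using mean_in \<open>Suc s \<in> {1..t}\<close> .
  have img: "a ` {1..s} = {..<length (cs s)}"
    and mean: "\<And>r. r \<in> {1..s} \<Longrightarrow> core_mean (cs s ! a r) \<in> V (c r)"
    using tr by (auto simp: tracks_def)
  have nr: "dist (\<mu> (X (Suc s))) (core_mean (cs s ! k)) \<le> \<theta>" if "k < length (cs s)" "?P k" for k
    using that x mean near[OF \<open>Suc s \<in> {1..t}\<close>] by metis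
  have fr: "dist (\<mu> (X (Suc s))) (core_mean (cs s ! k)) > \<theta>" if k: "k < length (cs s)" "\<not> ?P k" for k
  proof -
    \<comment> \<open>Every position was used by some earlier step, so a core element outside
      \<open>?P\<close> has a label, and this label differs from \<open>c (Suc s)\<close>.\<close>
    obtain r where r: "r \<in> {1..s}" "k = a r" using img k by blast
    with k have "c (Suc s) \<noteq> c r" by force
    moreover have "r \<in> {1..t}" using r s by simp
    ultimately show ?thesis using far[OF \<open>Suc s \<in> {1..t}\<close>] x mean r by blast
  qed
  from step show thesis
  proof (rule coreset_step_separatedE[where P = ?P])
    show "dist (\<mu> (X (Suc s))) (core_mean (cs s ! k)) \<le> \<theta>" if "k < length (cs s)" "?P k" for k
      using nr that .
    show "dist (\<mu> (X (Suc s))) (core_mean (cs s ! k)) > \<theta>" if "k < length (cs s)" "\<not> ?P k" for k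
      using fr that .
  next
    fix p
    assume *: "\<And>k. k < length (cs s) \<Longrightarrow> \<not> ?P k" "a (Suc s) = length (cs s)"
      "cs (Suc s) = cs s @ [Core (\<mu> (X (Suc s))) p]"
    have "c r \<noteq> c (Suc s)" if "r \<in> {1..s}" for r using *(1)[of "a r"] img that by blast
    with * create show thesis by blast
  next
    fix p
    assume *: "a (Suc s) < length (cs s)" "?P (a (Suc s))" "0 \<le> \<alpha> (Suc s)" "\<alpha> (Suc s) \<le> 1"
      "cs (Suc s) = (cs s)[a (Suc s) := Core ((1 - \<alpha> (Suc s)) *\<^sub>R core_mean (cs s ! a (Suc s))
         + \<alpha> (Suc s) *\<^sub>R \<mu> (X (Suc s))) p]"
    from *(2) obtain r where "r \<in> {1..s}" "a r = a (Suc s)" "c r = c (Suc s)" by blast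
    with * update[of r p] show thesis by simp
  qed
qed

text \<open>The invariant puts positions and the labels seen so far in bijection. Keeping each mean
  in the region of its label is what makes the outcome of the next step predictable, so all three
  conjuncts go through the induction together.\<close>

lemma tracks: "s \<le> t \<Longrightarrow> tracks V c s (cs s) a"
proof (induction s)
  case 0
  show ?case using run by (simp add: tracks_def coreset_run_def)
next
  case (Suc s)
  then have tr: "tracks V c s (cs s) a" by simp
  have img: "a ` {1..s} = {..<length (cs s)}"
    and same: "\<And>q r. q \<in> {1..s} \<Longrightarrow> r \<in> {1..s} \<Longrightarrow> a q = a r \<longleftrightarrow> c q = c r"
    and mean: "\<And>r. r \<in> {1..s} \<Longrightarrow> core_mean (cs s ! a r) \<in> V (c r)"
    using tr by (auto simp: tracks_def)
  have lt: "a r < length (cs s)" if "r \<in> {1..s}" for r using img that by blast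
  have ins: "{1..Suc s} = insert (Suc s) {1..s}" by auto
  have x: "\<mu> (X (Suc s)) \<in> V (c (Suc s))" using Suc.prems by (intro mean_in) simp
  from Suc.prems tr show ?case
  proof (cases rule: stepE)
    case (create p)
    \<comment> \<open>Old positions lie below the old length: they differ from the new one, and
      appending leaves their means alone.\<close>
    have new: "a r \<noteq> a (Suc s)" "core_mean (cs (Suc s) ! a r) \<in> V (c r)" if "r \<in> {1..s}" for r
      using lt[OF that] mean[OF that] create by (auto simp: nth_append)
    have "core_mean (cs (Suc s) ! a (Suc s)) \<in> V (c (Suc s))" using create x by simp
    moreover have "a ` {1..Suc s} = {..<length (cs (Suc s))}"
      unfolding ins image_insert img using create by auto
    ultimately show ?thesis
      unfolding tracks_def using new same create(1) by (simp only: ins ball_simps) metis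
  next
    case (update p q)
    have "Suc s \<in> {1..t}" using Suc.prems by simp
    \<comment> \<open>Convexity and the bounds on the weight enter here: the new mean is a convex
      combination of two points of the same region.\<close>
    have upd: "core_mean (cs (Suc s) ! a q) \<in> V (c (Suc s))"
      using update x mean[OF update(1)] convexD_alt[OF convex_V[OF \<open>Suc s \<in> {1..t}\<close>]] by simp
    \<comment> \<open>Several earlier steps may share the updated position; by \<open>same\<close>
      they all carry the label \<open>c (Suc s)\<close>, so \<open>upd\<close> covers them.\<close>
    have "core_mean (cs (Suc s) ! a r) \<in> V (c r)" if "r \<in> {1..s}" for r
    proof (cases "a r = a q")
      case True
      then have "c r = c (Suc s)" using same[OF that update(1)] update(2) by simp
      then show ?thesis using upd True by simp
    qed (use update mean[OF that] in simp)
    moreover have "a ` {1..Suc s} = {..<length (cs (Suc s))}"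
      unfolding ins image_insert img using update by auto
    ultimately show ?thesis
      unfolding tracks_def using upd same update(1-3) by (simp only: ins ball_simps) metis
  qed
qed

lemma assigned_less_length_iff:
  assumes "Suc s \<le> t"
  shows "a (Suc s) < length (cs s) \<longleftrightarrow> (\<exists>r\<in>{1..s}. c r = c (Suc s))"
  using assms tracks[OF Suc_leD[OF assms]] by (cases rule: stepE) auto

lemma assigned_eq_length:
  assumes "Suc s \<le> t" "\<not> a (Suc s) < length (cs s)"
  shows "a (Suc s) = length (cs s)"
  using assms(1) tracks[OF Suc_leD[OF assms(1)]] assms(2) by (cases rule: stepE) auto

text \<open>The assignments \<open>a\<close> are fixed once made, so the invariant after the last
  step compares any two steps of the run.\<close>

lemma assigned_eq_iff:
  assumes "q \<in> {1..t}" "r \<in> {1..t}"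
  shows "a q = a r \<longleftrightarrow> c q = c r"
  using tracks[of t] assms by (simp add: tracks_def)

lemma image_assigned: "s \<le> t \<Longrightarrow> a ` {1..s} = {..<length (cs s)}"
  using tracks by (simp add: tracks_def)

section \<open>Core means as running averages\<close>

text \<open>If \<open>n\<close> earlier batches with sum \<open>S\<close> have average
  \<open>S / n\<close>, then weight \<open>1 / (n + 1)\<close> turns it into
  \<open>(S + x) / (n + 1)\<close> for the new mean \<open>x\<close>. The weight is prescribed only
  at updates; a created element starts as the average of one batch.\<close>

lemma core_mean_eq_average:
  assumes weights: "\<And>s. s \<in> {1..t} \<Longrightarrow> a s < length (cs (s - 1)) \<Longrightarrow>
      \<alpha> s = 1 / real (card {q \<in> {1..s}. c q = c s})"
  shows "s \<le> t \<Longrightarrow> r \<in> {1..s} \<Longrightarrow> core_mean (cs s ! a r) =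
    (1 / real (card {q \<in> {1..s}. c q = c r})) *\<^sub>R (\<Sum>q | q \<in> {1..s} \<and> c q = c r. \<mu> (X q))"
proof (induction s arbitrary: r)
  case (Suc s)
  let ?A = "\<lambda>s i. {q \<in> {1..s}. c q = i}"
  have IH: "core_mean (cs s ! a q) =
      (1 / real (card (?A s (c q)))) *\<^sub>R sum (\<lambda>q. \<mu> (X q)) (?A s (c q))" if "q \<in> {1..s}" for q
    using Suc that by simp
  have ins: "{1..Suc s} = insert (Suc s) {1..s}" by auto
  have A_same: "?A (Suc s) (c (Suc s)) = insert (Suc s) (?A s (c (Suc s)))" by auto
  have A_other: "?A (Suc s) i = ?A s i" if "i \<noteq> c (Suc s)" for i
    using that by (auto simp: le_Suc_eq)
  have [simp]: "a r < length (cs s)" if "r \<in> {1..s}" for r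
    using image_assigned[of s] Suc.prems(1) that by auto
  \<comment> \<open>A different label means a different position, which neither appending nor the
    list update touches.\<close>
  have old: "core_mean (cs (Suc s) ! a r) = core_mean (cs s ! a r)" if "c r \<noteq> c (Suc s)" "r \<in> {1..s}"
  proof -
    have ne: "a r \<noteq> a (Suc s)" using that assigned_eq_iff[of r "Suc s"] Suc.prems by simp
    from Suc.prems(1) tracks[OF Suc_leD[OF Suc.prems(1)]] ne that show ?thesis
      by (cases rule: stepE) (auto simp: nth_append)
  qed
  have same: "core_mean (cs (Suc s) ! a (Suc s)) = (1 / real (card (?A (Suc s) (c (Suc s))))) *\<^sub>R
      sum (\<lambda>q. \<mu> (X q)) (?A (Suc s) (c (Suc s)))"
    using Suc.prems(1) tracks[OF Suc_leD[OF Suc.prems(1)]]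
  proof (cases rule: stepE)
    case (create p)
    then have A: "?A (Suc s) (c (Suc s)) = {Suc s}" unfolding A_same by auto
    show ?thesis unfolding A using create by simp
  next
    case (update p q)
    define n where "n = card (?A s (c (Suc s)))"
    define S where "S = sum (\<lambda>q. \<mu> (X q)) (?A s (c (Suc s)))"
    have n: "n > 0" unfolding n_def using update(1,2) by (subst card_gt_0_iff) auto
    have card': "card (?A (Suc s) (c (Suc s))) = Suc n" unfolding A_same n_def by simp
    have "\<alpha> (Suc s) = 1 / real (Suc n)"
      using weights[of "Suc s"] Suc.prems(1) update card' by simp
    moreover have "core_mean (cs s ! a q) = (1 / real n) *\<^sub>R S"
      using IH[OF update(1)] update(2) by (simp add: n_def S_def)
    moreover have "sum (\<lambda>q. \<mu> (X q)) (?A (Suc s) (c (Suc s))) = S + \<mu> (X (Suc s))"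
      unfolding A_same S_def by simp
    \<comment> \<open>This is the coefficient of \<open>S\<close> after the update; cancelling
      \<open>n\<close> relies on the earlier step \<open>q\<close>, which makes \<open>n\<close>
      positive.\<close>
    moreover have "(1 - 1 / real (Suc n)) * (1 / real n) = 1 / real (Suc n)"
      using n by (simp add: field_simps)
    ultimately show ?thesis using update(3,4,7) card' by (simp add: scaleR_add_right)
  qed
  show ?case
  proof (cases "c r = c (Suc s)")
    case True
    then have "a r = a (Suc s)" using assigned_eq_iff[of r "Suc s"] Suc.prems by simp
    with same True show ?thesis by simp
  next
    case False
    then have "r \<in> {1..s}" using Suc.prems(2) by (auto simp: le_Suc_eq)
    with old IH False show ?thesis by (simp only: A_other not_False_eq_True)
  qed
qed simp

end

section \<open>From labelled steps to batch indices and clusters\<close>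

theorem propositionB2:
  fixes \<mu> :: "'b \<Rightarrow> real ^ 'n"
    and B :: "nat \<Rightarrow> 'b"
    and G :: "nat \<Rightarrow> nat set"
    and t M :: nat
    and \<theta> :: real
  assumes "t > 1"
    and "(\<Union>i\<in>{1..M}. G i) = {1..t}"
    and "disjoint_family_on G {1..M}"
    and "\<And>i. i \<in> {1..M} \<Longrightarrow> G i \<noteq> {}"
    and "\<theta> > 0"
    and "\<And>i. i \<in> {1..M} \<Longrightarrow> diameter (convex hull ((\<lambda>s. \<mu> (B s)) ` G i)) < \<theta>"
    and "\<And>i j. i \<in> {1..M} \<Longrightarrow> j \<in> {1..M} \<Longrightarrow> i \<noteq> j \<Longrightarrow>
           \<theta> < setdist (convex hull ((\<lambda>s. \<mu> (B s)) ` G i)) (convex hull ((\<lambda>s. \<mu> (B s)) ` G j))"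
  shows "\<forall>\<pi> \<alpha> a. \<forall>cs :: nat \<Rightarrow> (real ^ 'n, 'p) core_elem list.
    \<pi> permutes {1..t - 1} \<longrightarrow> coreset_run \<theta> \<mu> (\<lambda>s. B (\<pi> s)) t \<alpha> cs a \<longrightarrow>
      (\<forall>i\<in>{1..M}. t \<in> G i \<longrightarrow> correctly_assigned \<pi> cs a (G i) t) \<and>
      ((\<forall>s\<in>{1..t}. \<forall>j\<in>{1..M}.
          a s < length (cs (s - 1)) \<and> core_of_cluster \<pi> cs a s (G j) (a s) \<longrightarrow>
          \<alpha> s = 1 / real (card (processed \<pi> s (G j)))) \<longrightarrow>
       (\<forall>i\<in>{1..M}.
          (\<exists>!k. core_of_cluster \<pi> cs a t (G i) k) \<and>
          (\<forall>k. core_of_cluster \<pi> cs a t (G i) k \<longrightarrow>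
             core_mean (cs t ! k) = (1 / real (card (G i))) *\<^sub>R (\<Sum>s\<in>G i. \<mu> (B s)))))"
proof (intro allI impI)
  fix \<pi> \<alpha> a and cs :: "nat \<Rightarrow> (real ^ 'n, 'p) core_elem list"
  assume \<pi>: "\<pi> permutes {1..t - 1}" and run: "coreset_run \<theta> \<mu> (\<lambda>s. B (\<pi> s)) t \<alpha> cs a"
  define V where "V i = convex hull ((\<lambda>s. \<mu> (B s)) ` G i)" for i
  \<comment> \<open>Only the first \<open>t - 1\<close> batches are permuted. Viewed on
    \<open>{1..t}\<close>, \<pi> fixes \<open>t\<close>, so batch \<open>t\<close> is processed in
    step \<open>t\<close>.\<close>
  have perm: "\<pi> permutes {1..t}" using \<pi> by (rule permutes_subset) auto
  have inj: "inj \<pi>" using \<pi> by (rule permutes_inj)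
  have \<pi>t: "\<pi> t = t" using \<pi> assms(1) by (simp add: permutes_def)
  have "\<exists>i\<in>{1..M}. \<pi> r \<in> G i" if "r \<in> {1..t}" for r
    using assms(2) permutes_in_image[OF perm, of r] that by blast
  then obtain c where c: "\<And>r. r \<in> {1..t} \<Longrightarrow> c r \<in> {1..M} \<and> \<pi> r \<in> G (c r)" by metis
  have c_iff: "\<pi> r \<in> G i \<longleftrightarrow> c r = i" if "r \<in> {1..t}" "i \<in> {1..M}" for r i
    using c[OF that(1)] assms(3) that(2) unfolding disjoint_family_on_def by blast
  \<comment> \<open>The real-valued \<open>diameter\<close> bounds distances only in a bounded set;
    finiteness of the clusters provides this.\<close>
  have bounded_V: "bounded (V i)" if "i \<in> {1..M}" for i
  proof -
    have "G i \<subseteq> {1..t}" using assms(2) that by blast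
    then have "finite (G i)" by (rule finite_subset) simp
    then show ?thesis unfolding V_def by (simp add: finite_imp_bounded_convex_hull)
  qed
  interpret separated_run \<theta> \<mu> "\<lambda>s. B (\<pi> s)" t \<alpha> cs a V c
  proof
    show "\<mu> (B (\<pi> r)) \<in> V (c r)" if "r \<in> {1..t}" for r
      unfolding V_def using c[OF that] by (intro hull_inc) auto
    show "dist x y \<le> \<theta>" if "r \<in> {1..t}" "x \<in> V (c r)" "y \<in> V (c r)" for r x y
      using diameter_bounded_bound[OF bounded_V that(2,3)] assms(6)[of "c r"] c[OF that(1)]
      by (simp add: V_def)
    show "\<theta> < dist x y"
      if "q \<in> {1..t}" "r \<in> {1..t}" "c q \<noteq> c r" "x \<in> V (c q)" "y \<in> V (c r)" for q r x y
      using setdist_le_dist[OF that(4,5)] assms(7)[of "c q" "c r"] c that by (auto simp: V_def)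
  qed (use run in \<open>simp_all add: V_def\<close>)

  have processed: "processed \<pi> s (G i) = \<pi> ` {r \<in> {1..s}. c r = i}" if "s \<le> t" "i \<in> {1..M}" for s i
    using c_iff that by (auto simp: processed_def)
  \<comment> \<open>The step \<open>r\<close> may come after \<open>s\<close>. The case
    \<open>r = t\<close>, \<open>s = t - 1\<close> compares the position chosen last with the
    batches assigned to it before.\<close>
  have batches_eq: "batches_of_core \<pi> a s (a r) = processed \<pi> s (G (c r))"
    if "r \<in> {1..t}" "s \<le> t" for r s
  proof -
    have "{q \<in> {1..s}. a q = a r} = {q \<in> {1..s}. c q = c r}"
      using assigned_eq_iff[of _ r] that by auto
    then show ?thesis using processed c that by (simp add: batches_of_core_def)
  qed
  have core_iff: "core_of_cluster \<pi> cs a s (G i) k \<longleftrightarrow> (\<exists>r\<in>{1..s}. c r = i \<and> k = a r)"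
    if s: "s \<le> t" and i: "i \<in> {1..M}" for s i k
  proof
    assume core: "core_of_cluster \<pi> cs a s (G i) k"
    then obtain r where r: "r \<in> {1..s}" "c r = i"
      using processed[OF s i] by (auto simp: core_of_cluster_def)
    then have "\<pi> r \<in> batches_of_core \<pi> a s k"
      using core processed[OF s i] by (auto simp: core_of_cluster_def)
    \<comment> \<open>Injectivity of \<pi> identifies the step that put the index
      \<open>\<pi> r\<close> into core \<open>k\<close> with \<open>r\<close> itself.\<close>
    then have "k = a r" using inj by (auto simp: batches_of_core_def dest: injD)
    with r show "\<exists>r\<in>{1..s}. c r = i \<and> k = a r" by blast
  next
    assume "\<exists>r\<in>{1..s}. c r = i \<and> k = a r"
    then obtain r where r: "r \<in> {1..s}" "c r = i" "k = a r" by blast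
    then have "k < length (cs s)" using image_assigned[OF s] by blast
    moreover have "processed \<pi> s (G i) \<noteq> {}" using r processed[OF s i] by auto
    ultimately show "core_of_cluster \<pi> cs a s (G i) k"
      using batches_eq[of r s] r s by (simp add: core_of_cluster_def)
  qed

  have "correctly_assigned \<pi> cs a (G i) t" if i: "i \<in> {1..M}" and t: "t \<in> G i" for i
  proof -
    have ct: "c t = i" using c_iff[of t i] \<pi>t t i assms(1) by simp
    \<comment> \<open>Both sides say that some step before \<open>t\<close> carries the label
      \<open>i\<close>.\<close>
    have "processed \<pi> (t - 1) (G i) \<noteq> {} \<longleftrightarrow> a t < length (cs (t - 1))"
      using processed[of "t - 1" i] i assigned_less_length_iff[of "t - 1"] assms(1) ct by auto
    then show ?thesis
      using assigned_eq_length[of "t - 1"] batches_eq[of t "t - 1"] assms(1) ct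
      by (simp add: correctly_assigned_def)
  qed
  moreover have "(\<exists>!k. core_of_cluster \<pi> cs a t (G i) k) \<and>
      (\<forall>k. core_of_cluster \<pi> cs a t (G i) k \<longrightarrow>
        core_mean (cs t ! k) = (1 / real (card (G i))) *\<^sub>R (\<Sum>s\<in>G i. \<mu> (B s)))"
    if weights: "\<forall>s\<in>{1..t}. \<forall>j\<in>{1..M}.
        a s < length (cs (s - 1)) \<and> core_of_cluster \<pi> cs a s (G j) (a s) \<longrightarrow>
        \<alpha> s = 1 / real (card (processed \<pi> s (G j)))" and i: "i \<in> {1..M}" for i
  proof -
    have w: "\<alpha> s = 1 / real (card {q \<in> {1..s}. c q = c s})"
      if s: "s \<in> {1..t}" and upd: "a s < length (cs (s - 1))" for s
    proof -
      \<comment> \<open>The weight hypothesis speaks of the core of a cluster after step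
        \<open>s\<close>; step \<open>s\<close> itself is the witness that \<open>a s\<close> is
        such a core.\<close>
      have "core_of_cluster \<pi> cs a s (G (c s)) (a s)"
        using core_iff[of s "c s" "a s"] c[OF s] s by auto
      then have "\<alpha> s = 1 / real (card (processed \<pi> s (G (c s))))"
        using weights s upd c[OF s] by blast
      also have "card (processed \<pi> s (G (c s))) = card {q \<in> {1..s}. c q = c s}"
        using processed[of s "c s"] c[OF s] s card_image[OF inj_on_subset[OF inj subset_UNIV]] by simp
      finally show ?thesis .
    qed
    have "G i \<subseteq> \<pi> ` {1..t}" using assms(2) i permutes_image[OF perm] by auto
    then have G: "G i = \<pi> ` {r \<in> {1..t}. c r = i}"
      using processed[of t i] i by (auto simp: processed_def)
    have "card (G i) = card {r \<in> {1..t}. c r = i}"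
      unfolding G by (rule card_image[OF inj_on_subset[OF inj subset_UNIV]])
    moreover have "(\<Sum>s\<in>G i. \<mu> (B s)) = (\<Sum>r | r \<in> {1..t} \<and> c r = i. \<mu> (B (\<pi> r)))"
      unfolding G by (simp add: sum.reindex[OF inj_on_subset[OF inj subset_UNIV]])
    ultimately have mean:
      "core_mean (cs t ! a r) = (1 / real (card (G i))) *\<^sub>R (\<Sum>s\<in>G i. \<mu> (B s))"
      if "r \<in> {1..t}" "c r = i" for r
      using core_mean_eq_average[OF w, of t r] that by simp
    obtain r where r: "r \<in> {1..t}" "c r = i" using G assms(4)[OF i] by blast
    \<comment> \<open>All steps with label \<open>i\<close> share one position, which gives
      uniqueness; existence comes from the nonempty cluster through \<open>r\<close>.\<close>
    have "core_of_cluster \<pi> cs a t (G i) k \<longleftrightarrow> k = a r" for k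
      using core_iff[OF order.refl i, of k] assigned_eq_iff[of r] r by metis
    with mean[OF r] show ?thesis by simp
  qed
  ultimately show "(\<forall>i\<in>{1..M}. t \<in> G i \<longrightarrow> correctly_assigned \<pi> cs a (G i) t) \<and>
      ((\<forall>s\<in>{1..t}. \<forall>j\<in>{1..M}.
          a s < length (cs (s - 1)) \<and> core_of_cluster \<pi> cs a s (G j) (a s) \<longrightarrow>
          \<alpha> s = 1 / real (card (processed \<pi> s (G j)))) \<longrightarrow>
       (\<forall>i\<in>{1..M}.
          (\<exists>!k. core_of_cluster \<pi> cs a t (G i) k) \<and>
          (\<forall>k. core_of_cluster \<pi> cs a t (G i) k \<longrightarrow>
             core_mean (cs t ! k) = (1 / real (card (G i))) *\<^sub>R (\<Sum>s\<in>G i. \<mu> (B s)))))"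
    by blast
qed

end
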